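(* Let $n\ge 1$ be an integer, let $F_X$ and $F_Y$ be univariate distribution functions, and let $C$ be a two-dimensional copula. For $(x,y)\in\mathbb{R}^2$ define $$G_{+}^{(n)}(x,y)=\frac1n\sum_{k=1}^{n}C\bigl(F_X^{k:n}(x),F_Y^{k:n}(y)\bigr),\qquad G_{-}^{(n)}(x,y)=\frac1n\sum_{k=1}^{n}C\bigl(F_X^{k:n}(x),F_Y^{n-k+1:n}(y)\bigr),$$ $$H_{+}^{(n)}(x,y)=\frac1n\sum_{k=1}^{n}F_X^{k:n}(x)F_Y^{k:n}(y),\qquad H_{-}^{(n)}(x,y)=\frac1n\sum_{k=1}^{n}F_X^{k:n}(x)F_Y^{n-k+1:n}(y).$$ If $C$ is positive quadrant dependent (PQD), then $\rho_{G_{+}^{(n)}}\ge \rho_{H_{+}^{(n)}}$; and if $C$ is negative quadrant dependent (NQD), then $\rho_{G_{-}^{(n)}}\le \rho_{H_{-}^{(n)}}$.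
   Context: A two-dimensional copula is a function $C:[0,1]^2\to[0,1]$ with $C(x,0)=C(0,y)=0$, $C(x,1)=x$, $C(1,y)=y$, and $C(x_2,y_2)-C(x_2,y_1)-C(x_1,y_2)+C(x_1,y_1)\ge 0$ whenever $0\le x_1<x_2\le 1$ and $0\le y_1<y_2\le 1$. The copula $C$ is PQD if $C(u,v)\ge uv$ for all $(u,v)\in[0,1]^2$, and NQD if $C(u,v)\le uv$ for all $(u,v)\in[0,1]^2$. If $X_1,\dots,X_n$ are i.i.d. with distribution function $F_X$ and $X_{1:n}\le\cdots\le X_{n:n}$ are their order statistics, then $F_X^{k:n}(x)=P\{X_{k:n}\le x\}=\sum_{i=k}^{n}\binom{n}{i}F_X(x)^i(1-F_X(x))^{n-i}$. The function $F_Y^{k:n}$ is defined in the same way from i.i.d. $Y_1,\dots,Y_n$ with distribution function $F_Y$. The functions $G_{\pm}^{(n)}$ and $H_{\pm}^{(n)}$ are bivariate distribution functions with marginals $F_X$ and $F_Y$. For a bivariate distribution function $H$, $\rho_H$ denotes the Pearson correlation coefficient of random variables $(X,Y)$ with joint distribution function $H$. *)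

theory Defs
  imports "HOL-Probability.Probability"
begin

definition univariate_df :: "(real \<Rightarrow> real) \<Rightarrow> bool" where
  "univariate_df F \<longleftrightarrow>
     mono F \<and> (\<forall>a. continuous (at_right a) F) \<and> (F \<longlongrightarrow> 0) at_bot \<and> (F \<longlongrightarrow> 1) at_top"

text \<open>
  For a distribution function \<open>F\<close>, \<open>interval_measure F\<close> is the distribution with cdf \<open>F\<close>
  (see \<open>real_distribution_interval_measure\<close> and \<open>cdf_interval_measure\<close>).
\<close>

definition finite_second_moment :: "(real \<Rightarrow> real) \<Rightarrow> bool" where
  "finite_second_moment F \<longleftrightarrow> integrable (interval_measure F) (\<lambda>x. x\<^sup>2)"

text \<open>
  Copulas are functions on the closed unit square; values of \<open>C\<close> outside it are unconstrained
  and irrelevant.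
\<close>

definition copula :: "(real \<Rightarrow> real \<Rightarrow> real) \<Rightarrow> bool" where
  "copula C \<longleftrightarrow>
     (\<forall>u\<in>{0..1}. \<forall>v\<in>{0..1}. C u v \<in> {0..1}) \<and>
     (\<forall>u\<in>{0..1}. C u 0 = 0 \<and> C 0 u = 0 \<and> C u 1 = u \<and> C 1 u = u) \<and>
     (\<forall>x1 x2 y1 y2. 0 \<le> x1 \<and> x1 < x2 \<and> x2 \<le> 1 \<and> 0 \<le> y1 \<and> y1 < y2 \<and> y2 \<le> 1 \<longrightarrow>
        C x2 y2 - C x2 y1 - C x1 y2 + C x1 y1 \<ge> 0)"

definition PQD :: "(real \<Rightarrow> real \<Rightarrow> real) \<Rightarrow> bool" where
  "PQD C \<longleftrightarrow> (\<forall>u\<in>{0..1}. \<forall>v\<in>{0..1}. C u v \<ge> u * v)"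

definition NQD :: "(real \<Rightarrow> real \<Rightarrow> real) \<Rightarrow> bool" where
  "NQD C \<longleftrightarrow> (\<forall>u\<in>{0..1}. \<forall>v\<in>{0..1}. C u v \<le> u * v)"

text \<open>
  \<open>order_stat_df F k n\<close> is the distribution function of the \<open>k\<close>-th smallest of \<open>n\<close> i.i.d.
  random variables with distribution function \<open>F\<close>.
\<close>

definition order_stat_df :: "(real \<Rightarrow> real) \<Rightarrow> nat \<Rightarrow> nat \<Rightarrow> real \<Rightarrow> real" where
  "order_stat_df F k n x = (\<Sum>i=k..n. real (n choose i) * F x ^ i * (1 - F x) ^ (n - i))"

definition G_plus ::
  "nat \<Rightarrow> (real \<Rightarrow> real \<Rightarrow> real) \<Rightarrow> (real \<Rightarrow> real) \<Rightarrow> (real \<Rightarrow> real) \<Rightarrow> real \<Rightarrow> real \<Rightarrow> real" where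
  "G_plus n C FX FY x y =
     1 / real n * (\<Sum>k=1..n. C (order_stat_df FX k n x) (order_stat_df FY k n y))"

definition G_minus ::
  "nat \<Rightarrow> (real \<Rightarrow> real \<Rightarrow> real) \<Rightarrow> (real \<Rightarrow> real) \<Rightarrow> (real \<Rightarrow> real) \<Rightarrow> real \<Rightarrow> real \<Rightarrow> real" where
  "G_minus n C FX FY x y =
     1 / real n * (\<Sum>k=1..n. C (order_stat_df FX k n x) (order_stat_df FY (n - k + 1) n y))"

definition H_plus ::
  "nat \<Rightarrow> (real \<Rightarrow> real) \<Rightarrow> (real \<Rightarrow> real) \<Rightarrow> real \<Rightarrow> real \<Rightarrow> real" where
  "H_plus n FX FY x y =
     1 / real n * (\<Sum>k=1..n. order_stat_df FX k n x * order_stat_df FY k n y)"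

definition H_minus ::
  "nat \<Rightarrow> (real \<Rightarrow> real) \<Rightarrow> (real \<Rightarrow> real) \<Rightarrow> real \<Rightarrow> real \<Rightarrow> real" where
  "H_minus n FX FY x y =
     1 / real n * (\<Sum>k=1..n. order_stat_df FX k n x * order_stat_df FY (n - k + 1) n y)"

text \<open>
  The Borel probability measure on the plane with joint distribution function \<open>H\<close>; it is unique
  if it exists, and it exists exactly when \<open>H\<close> is a bivariate distribution function.
\<close>

definition joint_law :: "(real \<Rightarrow> real \<Rightarrow> real) \<Rightarrow> (real \<times> real) measure" where
  "joint_law H =
     (THE \<mu>. prob_space \<mu> \<and> sets \<mu> = sets borel \<and> (\<forall>x y. measure \<mu> ({..x} \<times> {..y}) = H x y))"

text \<open>
  The usual correlation coefficient when \<open>X\<close> and \<open>Y\<close> have finite second moments and positive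
  variances. If one of the variances is zero, its value is \<open>0\<close> (division by zero).
\<close>

definition pearson_correlation :: "'a measure \<Rightarrow> ('a \<Rightarrow> real) \<Rightarrow> ('a \<Rightarrow> real) \<Rightarrow> real" where
  "pearson_correlation M X Y =
     prob_space.expectation M
       (\<lambda>\<omega>. (X \<omega> - prob_space.expectation M X) * (Y \<omega> - prob_space.expectation M Y)) /
     (sqrt (prob_space.variance M X) * sqrt (prob_space.variance M Y))"

definition rho :: "(real \<Rightarrow> real \<Rightarrow> real) \<Rightarrow> real" where
  "rho H = pearson_correlation (joint_law H) fst snd"

end

theory Submission
  imports Defs
begin

text \<open>
  The marginal distributions of the \<open>G\<close>'s and \<open>H\<close>'s are \<open>FX\<close> and \<open>FY\<close>, so everything reduces to
  comparing \<open>E[XY]\<close>, and \<open>E[XY]\<close> is monotone in the joint distribution function when the marginals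
  are fixed. The order statistics satisfy \<open>F\<^sup>k\<^sup>:\<^sup>n = B\<^sub>k \<circ> F\<close> with increasing polynomials \<open>B\<^sub>k\<close> on the unit
  interval whose average is the identity; hence each of the four functions has the form
  \<open>D (FX x) (FY y)\<close> where \<open>D\<close> is again a copula, namely the average of \<open>C (B\<^sub>k u) (B\<^sub>k v)\<close>,
  or \<open>C (B\<^sub>k u) (B\<^sub>n\<^sub>-\<^sub>k\<^sub>+\<^sub>1 v)\<close>, with \<open>C\<close> possibly replaced by the product copula.

  That a copula is the distribution function of a probability measure is shown by disintegration:
  let \<open>U\<close>, \<open>T\<close> be independent and uniform, let \<open>f q\<close> be the Radon-Nikodym density of \<open>dC(\<cdot>, q)\<close>
  for rational \<open>q\<close>, and take the law of \<open>(U, inf {q. T \<le> f q U})\<close>. Quantile transformations then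
  produce arbitrary marginals.
\<close>

section \<open>Subuniform laws on the unit interval and their densities\<close>

text \<open>Half-lines form an intersection-stable generator of the Borel sets, and the sets on
  which the masses add up are closed under complements and disjoint countable unions. The whole line
  is not a half-line, so the total masses are matched beforehand as limits of the cdfs.\<close>

lemma cdf_add_imp_emeasure_add:
  assumes M: "finite_borel_measure M" and N: "finite_borel_measure N" and L: "finite_borel_measure L"
    and cdf: "\<And>x. cdf M x + cdf N x = cdf L x"
    and A: "A \<in> sets borel"
  shows "emeasure M A + emeasure N A = emeasure L A"
proof -
  interpret M: finite_borel_measure M by fact
  interpret N: finite_borel_measure N by fact
  interpret L: finite_borel_measure L by fact
  have sets_borel: "sigma_sets UNIV (range atMost) = sets (borel :: real measure)"
    by (subst borel_eq_atMost) (simp add: sets_measure_of)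
  have total: "measure M UNIV + measure N UNIV = measure L UNIV"
  proof (rule LIMSEQ_unique)
    show "(\<lambda>i. cdf M (real i) + cdf N (real i)) \<longlonglongrightarrow> measure M UNIV + measure N UNIV"
      using tendsto_add[OF M.cdf_lim_infty N.cdf_lim_infty] by (simp add: M.borel_UNIV N.borel_UNIV)
    show "(\<lambda>i. cdf M (real i) + cdf N (real i)) \<longlonglongrightarrow> measure L UNIV"
      using L.cdf_lim_infty by (simp add: cdf L.borel_UNIV)
  qed
  have "Int_stable (range (atMost :: real \<Rightarrow> real set))" "range (atMost :: real \<Rightarrow> real set) \<subseteq> Pow UNIV"
    "A \<in> sigma_sets UNIV (range atMost)"
    using A by (auto simp: sets_borel Int_stable_def)
  then have "measure M A + measure N A = measure L A"
  proof (induction rule: sigma_sets_induct_disjoint)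
    case (union A)
    then have A: "range A \<subseteq> sets M" "range A \<subseteq> sets N" "range A \<subseteq> sets L"
      by (auto simp: sets_borel)
    have "(\<lambda>i. measure M (A i) + measure N (A i)) sums (measure M (\<Union>i. A i) + measure N (\<Union>i. A i))"
      by (intro sums_add M.finite_measure_UNION N.finite_measure_UNION A union)
    moreover have "(\<lambda>i. measure L (A i)) sums measure L (\<Union>i. A i)"
      by (intro L.finite_measure_UNION A union)
    ultimately show ?case
      using union by (simp add: sums_unique2)
  next
    case (compl A)
    then have "A \<in> sets M" "A \<in> sets N" "A \<in> sets L"
      by (auto simp: sets_borel)
    then show ?case
      using compl total M.finite_measure_compl[of A] N.finite_measure_compl[of A]
        L.finite_measure_compl[of A]
      by (simp add: M.borel_UNIV N.borel_UNIV L.borel_UNIV)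
  qed (use cdf in \<open>auto simp: cdf_def Int_stable_def\<close>)
  then show ?thesis
    by (simp add: M.emeasure_eq_measure N.emeasure_eq_measure L.emeasure_eq_measure
        flip: ennreal_plus)
qed

text \<open>\<open>interval_measure\<close> takes a function on the whole line. Composition with
  this retraction extends a function on the unit interval by constants and keeps monotonicity and
  Lipschitz bounds.\<close>

definition clamp_unit :: "real \<Rightarrow> real" where
  "clamp_unit u = max 0 (min 1 u)"

lemma clamp_unit_id: "0 \<le> u \<Longrightarrow> u \<le> 1 \<Longrightarrow> clamp_unit u = u"
  and clamp_unit_ge0: "0 \<le> clamp_unit u"
  and clamp_unit_le1: "clamp_unit u \<le> 1"
  and clamp_unit_mono: "u \<le> v \<Longrightarrow> clamp_unit u \<le> clamp_unit v"
  and clamp_unit_dist: "u \<le> v \<Longrightarrow> clamp_unit v - clamp_unit u \<le> v - u"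
  and clamp_unit_nonpos: "u \<le> 0 \<Longrightarrow> clamp_unit u = 0"
  and clamp_unit_ge1: "1 \<le> u \<Longrightarrow> clamp_unit u = 1"
  by (auto simp: clamp_unit_def)

text \<open>Encodes that both \<open>\<Phi>\<close> and \<open>u - \<Phi> u\<close> are
  nondecreasing on the unit interval, so that the law of \<open>\<Phi>\<close> is dominated by the
  uniform law. The sections of a copula are of this kind.\<close>

definition subuniform :: "(real \<Rightarrow> real) \<Rightarrow> bool" where
  "subuniform \<Phi> \<longleftrightarrow> \<Phi> 0 = 0 \<and>
     (\<forall>u v. 0 \<le> u \<and> u \<le> v \<and> v \<le> 1 \<longrightarrow> 0 \<le> \<Phi> v - \<Phi> u \<and> \<Phi> v - \<Phi> u \<le> v - u)"

definition unit_law :: "(real \<Rightarrow> real) \<Rightarrow> real measure" where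
  "unit_law \<Phi> = interval_measure (\<lambda>u. \<Phi> (clamp_unit u))"

abbreviation unif :: "real measure" where
  "unif \<equiv> unit_law (\<lambda>u. u)"

lemma subuniform_id: "subuniform (\<lambda>u. u)"
  by (simp add: subuniform_def)

lemma
  assumes "subuniform \<Phi>"
  shows finite_unit_law: "finite_borel_measure (unit_law \<Phi>)"
    and cdf_unit_law: "cdf (unit_law \<Phi>) u = \<Phi> (clamp_unit u)"
proof -
  let ?g = "\<lambda>u. \<Phi> (clamp_unit u)"
  have mono: "?g u \<le> ?g v" if "u \<le> v" for u v
    using assms clamp_unit_mono[OF that] clamp_unit_ge0[of u] clamp_unit_le1[of v]
    unfolding subuniform_def by (metis diff_ge_0_iff_ge)
  have step: "\<bar>?g v - ?g u\<bar> \<le> v - u" if "u \<le> v" for u v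
    using assms clamp_unit_mono[OF that] clamp_unit_ge0[of u] clamp_unit_le1[of v]
      clamp_unit_dist[OF that] mono[OF that]
    unfolding subuniform_def by (smt (verit))
  have "1-lipschitz_on UNIV ?g"
  proof (rule lipschitz_onI)
    show "dist (?g u) (?g v) \<le> 1 * dist u v" for u v
      using step[of u v] step[of v u] by (cases "u \<le> v") (auto simp: dist_real_def)
  qed simp
  then have "continuous_on UNIV ?g"
    by (rule lipschitz_on_continuous_on)
  then have cont: "continuous (at_right a) ?g" for a
    by (simp add: continuous_on_eq_continuous_at continuous_at_imp_continuous_at_within)
  have bot: "(?g \<longlongrightarrow> 0) at_bot"
    by (rule tendsto_eventually)
      (use assms in \<open>auto simp: eventually_at_bot_linorder clamp_unit_nonpos subuniform_def intro!: exI[of _ 0]\<close>)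
  have top: "(?g \<longlongrightarrow> \<Phi> 1) at_top"
    by (rule tendsto_eventually)
      (auto simp: eventually_at_top_linorder clamp_unit_ge1 intro!: exI[of _ 1])
  have "0 \<le> \<Phi> 1"
    using assms unfolding subuniform_def by (metis diff_zero order_refl zero_le_one)
  then show "finite_borel_measure (unit_law \<Phi>)"
    unfolding unit_law_def using mono cont bot top by (intro finite_borel_measure_interval_measure)
  show "cdf (unit_law \<Phi>) u = \<Phi> (clamp_unit u)"
    unfolding unit_law_def using mono cont bot by (subst cdf_interval_measure) auto
qed

lemma sets_unit_law [simp, measurable_cong]: "sets (unit_law \<Phi>) = sets borel"
  and space_unit_law [simp]: "space (unit_law \<Phi>) = UNIV"
  by (simp_all add: unit_law_def)

lemma prob_space_unif: "prob_space unif"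
proof -
  interpret finite_borel_measure unif
    by (rule finite_unit_law[OF subuniform_id])
  have "(\<lambda>i. cdf unif (real i)) \<longlonglongrightarrow> 1"
    by (rule tendsto_eventually)
      (auto simp: eventually_sequentially cdf_unit_law[OF subuniform_id] clamp_unit_ge1 intro!: exI[of _ 1])
  with cdf_lim_infty have "measure unif UNIV = 1"
    by (auto dest: LIMSEQ_unique)
  then show ?thesis
    by (intro prob_spaceI) (simp add: emeasure_eq_measure)
qed

lemma unit_law_add:
  assumes "subuniform \<Phi>" "subuniform \<Psi>" "subuniform \<Theta>"
    and "\<And>u. 0 \<le> u \<Longrightarrow> u \<le> 1 \<Longrightarrow> \<Phi> u + \<Psi> u = \<Theta> u"
    and "A \<in> sets borel"
  shows "emeasure (unit_law \<Phi>) A + emeasure (unit_law \<Psi>) A = emeasure (unit_law \<Theta>) A"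
  by (rule cdf_add_imp_emeasure_add)
    (use assms in \<open>auto simp: finite_unit_law cdf_unit_law clamp_unit_ge0 clamp_unit_le1\<close>)

lemma subuniform_diff:
  assumes "subuniform \<Phi>" "subuniform \<Theta>"
    and "\<And>u v. 0 \<le> u \<Longrightarrow> u \<le> v \<Longrightarrow> v \<le> 1 \<Longrightarrow> \<Phi> v - \<Phi> u \<le> \<Theta> v - \<Theta> u"
  shows "subuniform (\<lambda>u. \<Theta> u - \<Phi> u)"
  using assms unfolding subuniform_def by (smt (verit))

text \<open>Since \<open>u - \<Phi> u\<close> is again subuniform, \<open>unif\<close> is the sum of
  the two corresponding laws. Hence its null sets are null for each summand and Radon-Nikodym
  applies.\<close>

lemma unit_law_density_exists:
  assumes "subuniform \<Phi>"
  shows "\<exists>f\<in>borel_measurable borel. density unif f = unit_law \<Phi>"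
proof -
  interpret prob_space unif by (rule prob_space_unif)
  have "subuniform (\<lambda>u. u - \<Phi> u)"
    using assms subuniform_diff[OF assms subuniform_id] by (auto simp: subuniform_def)
  then have add: "emeasure (unit_law \<Phi>) A + emeasure (unit_law (\<lambda>u. u - \<Phi> u)) A = emeasure unif A"
    if "A \<in> sets borel" for A
    using that assms by (intro unit_law_add subuniform_id) auto
  have "absolutely_continuous unif (unit_law \<Phi>)"
    unfolding absolutely_continuous_def null_sets_def
    using add by auto (metis add_eq_0_iff_both_eq_0)
  from Radon_Nikodym[OF this] show ?thesis
    by (simp add: measurable_cong_sets[OF sets_unit_law refl])
qed

text \<open>The difference \<open>\<Theta> - \<Phi>\<close> is subuniform, so it has a nonnegative
  density \<open>h\<close>. Then \<open>f + h\<close> and \<open>g\<close> are densities of the same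
  law and agree almost everywhere.\<close>

lemma AE_density_mono:
  assumes \<Phi>: "subuniform \<Phi>" and \<Theta>: "subuniform \<Theta>"
    and le: "\<And>u v. 0 \<le> u \<Longrightarrow> u \<le> v \<Longrightarrow> v \<le> 1 \<Longrightarrow> \<Phi> v - \<Phi> u \<le> \<Theta> v - \<Theta> u"
    and f [measurable]: "f \<in> borel_measurable borel" and df: "density unif f = unit_law \<Phi>"
    and g [measurable]: "g \<in> borel_measurable borel" and dg: "density unif g = unit_law \<Theta>"
  shows "AE x in unif. f x \<le> g x"
proof -
  interpret prob_space unif by (rule prob_space_unif)
  have sub: "subuniform (\<lambda>u. \<Theta> u - \<Phi> u)"
    by (rule subuniform_diff[OF \<Phi> \<Theta> le])
  obtain h where h [measurable]: "h \<in> borel_measurable borel"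
    and dh: "density unif h = unit_law (\<lambda>u. \<Theta> u - \<Phi> u)"
    using unit_law_density_exists[OF sub] by auto
  have "density unif (\<lambda>x. f x + h x) = density unif g"
  proof (rule measure_eqI)
    fix A assume "A \<in> sets (density unif (\<lambda>x. f x + h x))"
    then have A: "A \<in> sets borel" by simp
    then have "emeasure (density unif (\<lambda>x. f x + h x)) A = emeasure (unit_law \<Phi>) A + emeasure (unit_law (\<lambda>u. \<Theta> u - \<Phi> u)) A"
      by (subst emeasure_density_add[symmetric]) (simp_all add: df dh)
    also have "\<dots> = emeasure (density unif g) A"
      unfolding dg by (rule unit_law_add[OF \<Phi> sub \<Theta> _ A]) simp
    finally show "emeasure (density unif (\<lambda>x. f x + h x)) A = emeasure (density unif g) A" .
  qed simp
  then have "AE x in unif. f x + h x = g x"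
    by (intro density_unique) auto
  then show ?thesis
    by eventually_elim (metis le_iff_add)
qed

text \<open>Comparison with the constant density 1 of \<open>unif\<close> bounds the density by 1
  almost everywhere, so truncating it at 1 makes the bound hold everywhere without changing the
  law.\<close>

lemma unit_law_density_real:
  assumes "subuniform \<Phi>"
  obtains f :: "real \<Rightarrow> real" where "f \<in> borel_measurable borel" "\<And>x. 0 \<le> f x" "\<And>x. f x \<le> 1"
    "density unif f = unit_law \<Phi>"
proof -
  interpret prob_space unif by (rule prob_space_unif)
  obtain g where g [measurable]: "g \<in> borel_measurable borel" and dg: "density unif g = unit_law \<Phi>"
    using unit_law_density_exists[OF assms] by auto
  have le1: "AE x in unif. g x \<le> 1"
    by (rule AE_density_mono[OF assms subuniform_id _ g dg])
      (use assms in \<open>auto simp: subuniform_def density_1\<close>)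
  define f where "f x = enn2real (min 1 (g x))" for x
  have f [measurable]: "f \<in> borel_measurable borel"
    unfolding f_def by measurable
  have f_eq: "ennreal (f x) = min 1 (g x)" for x
    unfolding f_def by (intro ennreal_enn2real) (simp add: min_less_iff_disj)
  then have "density unif f = density unif g"
    using le1 by (intro density_cong) (auto simp: min_def)
  moreover have "f x \<le> 1" for x
    using f_eq[of x] by (metis ennreal_le_1 min.cobounded1)
  ultimately show thesis
    using that[of f] dg by (auto simp: f_def)
qed

section \<open>The law of a copula\<close>

text \<open>The rectangle inequality, rearranged to say that increments in the second argument grow
  with the first, and extended to degenerate rectangles, where both sides agree.\<close>

lemma copula_2_increasing:
  assumes "copula C" "0 \<le> u" "u \<le> u'" "u' \<le> 1" "0 \<le> v" "v \<le> v'" "v' \<le> 1"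
  shows "C u v' - C u v \<le> C u' v' - C u' v"
proof (cases "u = u' \<or> v = v'")
  case False
  then have "u < u'" "v < v'" using assms by auto
  then have "C u' v' - C u' v - C u v' + C u v \<ge> 0"
    using assms unfolding copula_def by blast
  then show ?thesis by simp
qed auto

lemma
  assumes "copula C" "0 \<le> u" "u \<le> 1"
  shows copula_0_left: "C 0 u = 0" and copula_0_right: "C u 0 = 0"
    and copula_1_left: "C 1 u = u" and copula_1_right: "C u 1 = u"
  using assms by (auto simp: copula_def)

lemma copula_mem_unit:
  assumes "copula C" "0 \<le> u" "u \<le> 1" "0 \<le> v" "v \<le> 1"
  shows "0 \<le> C u v" "C u v \<le> 1"
  using assms by (auto simp: copula_def)

text \<open>Rectangles resting on the lower edge of the square give monotonicity, and those reaching
  the upper edge give the Lipschitz bound.\<close>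

lemma subuniform_copula_left:
  assumes "copula C" "0 \<le> v" "v \<le> 1"
  shows "subuniform (\<lambda>u. C u v)"
  unfolding subuniform_def
proof (intro conjI allI impI; (elim conjE)?)
  show "C 0 v = 0" using assms by (simp add: copula_0_left)
  fix u u' :: real assume u: "0 \<le> u" "u \<le> u'" "u' \<le> 1"
  show "0 \<le> C u' v - C u v"
    using copula_2_increasing[of C u u' 0 v] u assms by (simp add: copula_0_right)
  show "C u' v - C u v \<le> u' - u"
    using copula_2_increasing[of C u u' v 1] u assms by (simp add: copula_1_right)
qed

lemma subuniform_copula_right:
  assumes "copula C" "0 \<le> u" "u \<le> 1"
  shows "subuniform (C u)"
  unfolding subuniform_def
proof (intro conjI allI impI; (elim conjE)?)
  show "C u 0 = 0" using assms by (simp add: copula_0_right)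
  fix v v' :: real assume v: "0 \<le> v" "v \<le> v'" "v' \<le> 1"
  show "0 \<le> C u v' - C u v"
    using copula_2_increasing[of C 0 u v v'] v assms by (simp add: copula_0_left)
  show "C u v' - C u v \<le> v' - v"
    using copula_2_increasing[of C u 1 v v'] v assms by (simp add: copula_1_left)
qed

lemma ex_rat_between:
  assumes "a < (b::real)"
  obtains q where "q \<in> \<rat>" "a < q" "q < b"
  using Rats_dense_in_real[OF assms] by auto

theorem copula_law_exists:
  assumes C: "copula C"
  obtains M :: "(real \<times> real) measure" where "prob_space M" "sets M = sets borel"
    "\<And>u v. 0 \<le> u \<Longrightarrow> u \<le> 1 \<Longrightarrow> 0 \<le> v \<Longrightarrow> v \<le> 1 \<Longrightarrow> measure M ({..u} \<times> {..v}) = C u v"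
proof -
  interpret U: prob_space unif by (rule prob_space_unif)
  interpret P: pair_prob_space unif unif ..
  let ?P = "unif \<Otimes>\<^sub>M unif"
  have "\<exists>f. f \<in> borel_measurable borel \<and> (\<forall>x. 0 \<le> f x) \<and> (\<forall>x. f x \<le> (1::real)) \<and>
      density unif f = unit_law (\<lambda>u. C u q)" if "0 \<le> q" "q \<le> 1" for q
    using unit_law_density_real[OF subuniform_copula_left[OF C that]] by metis
  \<comment> \<open>\<open>f q x\<close> plays the role of the conditional probability that the
    second coordinate is at most \<open>q\<close>, given that the first one equals
    \<open>x\<close>.\<close>
  then obtain f where "\<And>q. 0 \<le> q \<Longrightarrow> q \<le> 1 \<Longrightarrow> f q \<in> borel_measurable borel \<and> (\<forall>x. 0 \<le> f q x)
      \<and> (\<forall>x. f q x \<le> (1::real)) \<and> density unif (f q) = unit_law (\<lambda>u. C u q)"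
    by metis
  then have f_meas: "f q \<in> borel_measurable borel" and f_ge0: "0 \<le> f q x" and f_le1: "f q x \<le> 1"
    and f_dens: "density unif (f q) = unit_law (\<lambda>u. C u q)" if "0 \<le> q" "q \<le> 1" for q x
    using that by auto
  \<comment> \<open>Monotonicity of \<open>f q x\<close> in \<open>q\<close> fails on a null set
    that depends on the pair of levels. With countably many levels one null set serves all
    pairs.\<close>
  define Q where "Q = \<rat> \<inter> {0..1::real}"
  have countable_Q: "countable Q"
    unfolding Q_def using countable_rat by blast
  have Q: "q \<in> Q \<Longrightarrow> 0 \<le> q" "q \<in> Q \<Longrightarrow> q \<le> 1" for q
    by (auto simp: Q_def)
  have f_meas_Q [measurable]: "q \<in> Q \<Longrightarrow> f q \<in> borel_measurable borel" for q
    using f_meas Q by auto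
  have "AE x in unif. \<forall>q\<in>Q. \<forall>q'\<in>Q. q \<le> q' \<longrightarrow> f q x \<le> f q' x"
  proof (intro AE_ball_countable[THEN iffD2] countable_Q ballI)
    fix q q' assume q: "q \<in> Q" "q' \<in> Q"
    show "AE x in unif. q \<le> q' \<longrightarrow> f q x \<le> f q' x"
    proof (cases "q \<le> q'")
      case True
      have "AE x in unif. ennreal (f q x) \<le> ennreal (f q' x)"
      proof (rule AE_density_mono[OF subuniform_copula_left[OF C] subuniform_copula_left[OF C]])
        fix u v :: real assume "0 \<le> u" "u \<le> v" "v \<le> 1"
        then show "C v q - C u q \<le> C v q' - C u q'"
          using copula_2_increasing[OF C, of u v q q'] True Q q by simp
      qed (use q Q in \<open>auto intro: f_dens\<close>)
      then show ?thesis
        by eventually_elim (use q Q f_ge0 in auto)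
    qed simp
  qed
  then have AE_mono: "AE p in ?P. \<forall>q\<in>Q. \<forall>q'\<in>Q. q \<le> q' \<longrightarrow> f q (fst p) \<le> f q' (fst p)"
    by (intro AE_distrD[of fst ?P unif]) (simp_all only: U.distr_pair_fst measurable_fst)

  \<comment> \<open>The conditional quantile of the second coordinate. The inserted 1 keeps the set
    nonempty and bounds \<open>Y\<close> by 1.\<close>
  define Y where "Y p = Inf (insert 1 {q \<in> Q. snd p \<le> f q (fst p)})" for p
  have bdd: "bdd_below (insert 1 {q \<in> Q. snd p \<le> f q (fst p)})" for p
    by (rule bdd_belowI[of _ 0]) (auto simp: Q_def)
  have Y_less: "Y p < v \<longleftrightarrow> 1 < v \<or> (\<exists>q\<in>Q. q < v \<and> snd p \<le> f q (fst p))" for p v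
    unfolding Y_def by (subst cInf_less_iff[OF _ bdd]) auto
  have Y_le1: "Y p \<le> 1" for p
    unfolding Y_def by (rule cInf_lower[OF _ bdd]) simp
  have Y_le: "Y p \<le> q" if "q \<in> Q" "snd p \<le> f q (fst p)" for p q
    unfolding Y_def by (rule cInf_lower[OF _ bdd]) (use that in simp)
  have Y_meas [measurable]: "Y \<in> borel_measurable ?P"
    unfolding borel_measurable_iff_less Y_less
  proof (rule allI)
    fix v :: real
    have "(\<lambda>p. \<exists>q\<in>Q. q < v \<and> snd p \<le> f q (fst p)) \<in> measurable ?P (count_space UNIV)"
      by (rule measurable_pred_countable(2)[OF countable_Q]) measurable
    then show "{p \<in> space ?P. 1 < v \<or> (\<exists>q\<in>Q. q < v \<and> snd p \<le> f q (fst p))} \<in> sets ?P"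
      by measurable
  qed
  \<comment> \<open>Fubini: the slice over \<open>x\<close> has uniform mass \<open>f q x\<close>,
    and integrating this over \<open>x \<le> u\<close> evaluates the law with density
    \<open>f q\<close>, whose cdf at \<open>u\<close> is \<open>C u q\<close>.\<close>
  have area: "measure ?P {p. fst p \<le> u \<and> snd p \<le> f q (fst p)} = C u q"
    and area_sets: "{p. fst p \<le> u \<and> snd p \<le> f q (fst p)} \<in> sets ?P"
    if u: "0 \<le> u" "u \<le> 1" and q: "q \<in> Q" for u q
  proof -
    let ?E = "{p. fst p \<le> u \<and> snd p \<le> f q (fst p)}"
    note [measurable] = f_meas_Q[OF q]
    have "{p \<in> space ?P. fst p \<le> u \<and> snd p \<le> f q (fst p)} \<in> sets ?P"
      by measurable
    then show E: "?E \<in> sets ?P"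
      by (simp add: space_pair_measure)
    have slice: "emeasure unif {..f q x} = ennreal (f q x)" for x
      using cdf_unit_law[OF subuniform_id, of "f q x"] f_ge0[of q x] f_le1[of q x] Q[OF q]
      by (simp add: U.emeasure_eq_measure cdf_def clamp_unit_id)
    have "Pair x -` ?E = (if x \<le> u then {..f q x} else {})" for x
      by auto
    then have "emeasure ?P ?E = (\<integral>\<^sup>+x. ennreal (f q x) * indicator {..u} x \<partial>unif)"
      by (subst U.emeasure_pair_measure_alt[OF E]) (auto intro!: nn_integral_cong simp: slice indicator_def)
    also have "\<dots> = emeasure (density unif (f q)) {..u}"
      by (subst emeasure_density) auto
    also have "\<dots> = emeasure (unit_law (\<lambda>u. C u q)) {..u}"
      using f_dens Q[OF q] by simp
    also have "\<dots> = ennreal (C u q)"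
    proof -
      interpret N: finite_borel_measure "unit_law (\<lambda>u. C u q)"
        using finite_unit_law subuniform_copula_left C Q q by blast
      show ?thesis
        using cdf_unit_law[OF subuniform_copula_left[OF C], of q u] Q[OF q] u
        by (simp add: N.emeasure_eq_measure cdf_def clamp_unit_id)
    qed
    finally show "measure ?P ?E = C u q"
      using copula_mem_unit[OF C u Q[OF q]] by (simp add: measure_def)
  qed

  define M where "M = distr ?P borel (\<lambda>p. (fst p, Y p))"
  have M_meas [measurable]: "(\<lambda>p. (fst p, Y p)) \<in> measurable ?P borel"
    by measurable
  have "measure M ({..u} \<times> {..v}) = C u v" if u: "0 \<le> u" "u \<le> 1" and v: "0 \<le> v" "v \<le> 1" for u v
  proof -
    let ?p = "measure ?P {p. fst p \<le> u \<and> Y p \<le> v}"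
    have sets_p: "{p. fst p \<le> u \<and> Y p \<le> v} \<in> sets ?P"
    proof -
      have "{p \<in> space ?P. fst p \<le> u \<and> Y p \<le> v} \<in> sets ?P"
        by measurable
      then show ?thesis by (simp add: space_pair_measure)
    qed
    have M_eq: "measure M ({..u} \<times> {..v}) = ?p"
      unfolding M_def by (subst measure_distr[OF M_meas])
        (auto simp: space_pair_measure borel_Times intro!: arg_cong[where f="measure ?P"])
    \<comment> \<open>Carries bounds at rational levels over to \<open>v\<close>, with an error of
      at most the distance between the levels.\<close>
    have lip: "C u v' - C u v \<le> v' - v" if "0 \<le> v" "v \<le> v'" "v' \<le> 1" for v v'
      using subuniform_copula_right[OF C u] that by (simp add: subuniform_def)
    \<comment> \<open>The event for \<open>Y\<close> is squeezed between events of known area: it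
      contains those of levels \<open>q \<le> v\<close>, and by almost sure monotonicity it lies, up
      to a null set, in those of levels \<open>q' > v\<close>.\<close>
    have lower: "C u q \<le> ?p" if "q \<in> Q" "q \<le> v" for q
      unfolding area[OF u \<open>q \<in> Q\<close>, symmetric] using that
      by (intro P.finite_measure_mono sets_p) (auto dest: Y_le)
    have "C u v \<le> ?p + e" if "0 < e" for e
    proof (cases "v = 0")
      case True
      then show ?thesis
        using that copula_0_right[OF C u] by simp
    next
      case False
      with v that have "max 0 (v - e) < v" by auto
      then obtain q where q: "q \<in> \<rat>" "max 0 (v - e) < q" "q < v"
        by (rule ex_rat_between)
      with v have "q \<in> Q" by (auto simp: Q_def)
      with lower[of q] lip[of q v] q v show ?thesis by auto
    qed
    then have ge: "C u v \<le> ?p"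
      by (rule field_le_epsilon)
    have upper: "?p \<le> C u q'" if q': "q' \<in> Q" "v < q'" for q'
      unfolding area[OF u \<open>q' \<in> Q\<close>, symmetric]
    proof (rule P.finite_measure_mono_AE[OF _ area_sets[OF u q'(1)]])
      show "AE p in ?P. p \<in> {p. fst p \<le> u \<and> Y p \<le> v} \<longrightarrow> p \<in> {p. fst p \<le> u \<and> snd p \<le> f q' (fst p)}"
        using AE_mono
      proof eventually_elim
        case (elim p)
        { assume "Y p \<le> v"
          then have "Y p < q'" using q' by simp
          then obtain q where "q \<in> Q" "q < q'" "snd p \<le> f q (fst p)"
            using Y_less Q[OF q'(1)] by auto
          then have "snd p \<le> f q' (fst p)"
            using elim q' by fastforce }
        then show ?case by auto
      qed
    qed
    have "?p \<le> C u v + e" if "0 < e" for e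
    proof (cases "v = 1")
      \<comment> \<open>No level of \<open>Q\<close> lies above 1, so the upper bound is read off
        the uniform first marginal.\<close>
      case True
      have "?p = measure ?P {p. fst p \<le> u}"
        using True Y_le1 by simp
      also have "\<dots> = measure (distr ?P unif fst) {..u}"
        by (subst measure_distr) (auto simp: space_pair_measure intro!: arg_cong[where f="measure ?P"])
      also have "\<dots> = u"
        using cdf_unit_law[OF subuniform_id, of u] u
        by (simp add: U.distr_pair_fst cdf_def clamp_unit_id)
      finally show ?thesis
        using True copula_1_right[OF C u] that by simp
    next
      case False
      with v that have "v < min 1 (v + e)" by auto
      then obtain q where q: "q \<in> \<rat>" "v < q" "q < min 1 (v + e)"
        by (rule ex_rat_between)
      with v have "q \<in> Q" by (auto simp: Q_def)
      with upper[of q] lip[of v q] q v show ?thesis by auto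
    qed
    then have "?p \<le> C u v"
      by (rule field_le_epsilon)
    with ge M_eq show ?thesis by simp
  qed
  moreover have "prob_space M"
    unfolding M_def by (rule P.prob_space_distr[OF M_meas])
  ultimately show thesis
    using that[of M] by (simp add: M_def)
qed

section \<open>Joint laws with given marginals\<close>

lemma univariate_dfD:
  assumes "univariate_df F"
  shows univariate_df_mono: "x \<le> y \<Longrightarrow> F x \<le> F y"
    and univariate_df_right_cont: "continuous (at_right a) F"
    and univariate_df_at_bot: "(F \<longlongrightarrow> 0) at_bot"
    and univariate_df_at_top: "(F \<longlongrightarrow> 1) at_top"
  using assms by (auto simp: univariate_df_def dest: monoD)

lemma real_distribution_univariate_df:
  "univariate_df F \<Longrightarrow> real_distribution (interval_measure F)"
  by (rule real_distribution_interval_measure) (auto dest: univariate_dfD)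

lemma cdf_univariate_df: "univariate_df F \<Longrightarrow> cdf (interval_measure F) = F"
  by (rule cdf_interval_measure) (auto dest: univariate_dfD)

lemma
  assumes "univariate_df F"
  shows univariate_df_ge0: "0 \<le> F x" and univariate_df_le1: "F x \<le> 1"
proof -
  interpret real_distribution "interval_measure F"
    by (rule real_distribution_univariate_df[OF assms])
  show "0 \<le> F x" "F x \<le> 1"
    using cdf_nonneg[of x] cdf_bounded_prob[of x] by (simp_all add: cdf_univariate_df[OF assms])
qed

section \<open>Quantile transforms\<close>

definition quantile :: "(real \<Rightarrow> real) \<Rightarrow> real \<Rightarrow> real" where
  "quantile F w = (if 0 < w \<and> w < 1 then Inf {x. w \<le> F x} else 0)"

text \<open>Right-continuity makes the infimum attained, which yields this Galois connection.
  Outside the open unit interval the set in \<open>quantile\<close> may be empty or unbounded below;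
  the default 0 used there falls on a null set later on.\<close>

lemma quantile_le_iff:
  assumes "univariate_df F" "0 < w" "w < 1"
  shows "quantile F w \<le> x \<longleftrightarrow> w \<le> F x"
proof -
  interpret right_continuous_mono F 0 1
    by unfold_locales (use assms(1) in \<open>auto simp: univariate_df_def\<close>)
  show ?thesis
    using pseudoinverse[of w x] assms by (simp add: quantile_def)
qed

lemma quantile_measurable [measurable]:
  assumes "univariate_df F"
  shows "quantile F \<in> borel_measurable borel"
  unfolding borel_measurable_iff_le
proof
  fix x
  have "{w \<in> space borel. quantile F w \<le> x} = {w. if 0 < w \<and> w < 1 then w \<le> F x else 0 \<le> x}"
    using quantile_le_iff[OF assms] by (auto simp: quantile_def)
  also have "\<dots> \<in> sets borel"
    by measurable
  finally show "{w \<in> space borel. quantile F w \<le> x} \<in> sets borel" .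
qed

definition has_joint_df :: "(real \<times> real) measure \<Rightarrow> (real \<Rightarrow> real \<Rightarrow> real) \<Rightarrow> bool" where
  "has_joint_df M H \<longleftrightarrow>
     prob_space M \<and> sets M = sets borel \<and> (\<forall>x y. measure M ({..x} \<times> {..y}) = H x y)"

text \<open>Lower-left quadrants are intersection-stable, generate the Borel sets of the plane, and
  exhaust it along the diagonal. This is what turns the definite description in
  \<open>joint_law\<close> into a usable value.\<close>

lemma has_joint_df_unique:
  assumes "has_joint_df M H" "has_joint_df N H"
  shows "M = N"
proof (rule measure_eqI_generator_eq[where \<Omega>=UNIV and E="range atMost" and A="\<lambda>i. {..(real i, real i)}"])
  interpret M: prob_space M using assms by (simp add: has_joint_df_def)
  interpret N: prob_space N using assms by (simp add: has_joint_df_def)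
  have box: "{..p} = {..fst p} \<times> {..snd p}" for p :: "real \<times> real"
    by (auto simp: less_eq_prod_def)
  fix X :: "(real \<times> real) set" assume "X \<in> range atMost"
  then show "emeasure M X = emeasure N X"
    using assms by (auto simp: has_joint_df_def M.emeasure_eq_measure N.emeasure_eq_measure box)
next
  have inf: "{..p} \<inter> {..q} = {..inf p q}" for p q :: "real \<times> real"
    by auto
  show "Int_stable (range (atMost :: real \<times> real \<Rightarrow> _))"
    unfolding Int_stable_def by (auto simp: inf)
  have sets_borel: "sigma_sets UNIV (range atMost) = sets (borel :: (real \<times> real) measure)"
    by (subst borel_eq_atMost) (simp add: sets_measure_of)
  show "sets M = sigma_sets UNIV (range atMost)" "sets N = sigma_sets UNIV (range atMost)"
    using assms by (simp_all add: has_joint_df_def sets_borel)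
  show "(\<Union>i. {..(real i, real i)}) = UNIV"
  proof (intro set_eqI iffI UNIV_I)
    fix p :: "real \<times> real"
    obtain i where "max (fst p) (snd p) \<le> real i"
      using real_arch_simple by blast
    then show "p \<in> (\<Union>i. {..(real i, real i)})"
      by (auto simp: less_eq_prod_def intro!: exI[of _ i])
  qed
  interpret M: prob_space M using assms by (simp add: has_joint_df_def)
  show "emeasure M {..(real i, real i)} \<noteq> \<infinity>" for i
    by simp
qed auto

lemma joint_law_eqI: "has_joint_df M H \<Longrightarrow> joint_law H = M"
  unfolding joint_law_def
  by (rule the_equality) (auto simp: has_joint_df_def intro: has_joint_df_unique[unfolded has_joint_df_def])

text \<open>The law of the copula is pushed forward by the two quantile functions. It is
  concentrated on the open unit square, where the Galois connection turns each quadrant event into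
  one for the copula.\<close>

lemma joint_law_copula:
  assumes C: "copula C" and F: "univariate_df F" and G: "univariate_df G"
  shows "has_joint_df (joint_law (\<lambda>x y. C (F x) (G y))) (\<lambda>x y. C (F x) (G y))"
proof -
  obtain M :: "(real \<times> real) measure" where "prob_space M" and sets_M: "sets M = sets borel"
    and M: "\<And>u v. 0 \<le> u \<Longrightarrow> u \<le> 1 \<Longrightarrow> 0 \<le> v \<Longrightarrow> v \<le> 1 \<Longrightarrow> measure M ({..u} \<times> {..v}) = C u v"
    using copula_law_exists[OF C] by metis
  interpret prob_space M by fact
  have sets_M_prod [measurable_cong]: "sets M = sets (borel \<Otimes>\<^sub>M borel)"
    by (simp only: sets_M borel_prod)
  have sp [simp]: "space M = UNIV"
    using sets_eq_imp_space_eq[OF sets_M] by simp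
  have box [measurable]: "{..u} \<times> {..v} \<in> sets M" for u v :: real
    by (simp add: sets_M borel_Times)
  \<comment> \<open>Excludes an atom at the upper edge: the mass strictly below 1 is at least
    \<open>1 - e\<close> for every small \<open>e\<close>.\<close>
  have lt1: "AE p in M. g p < 1"
    if [measurable]: "g \<in> borel_measurable M"
      and lower: "\<And>e. 0 < e \<Longrightarrow> e < 1 \<Longrightarrow> 1 - e \<le> prob {p. g p \<le> 1 - e}" for g
  proof -
    have "{p \<in> space M. g p < 1} \<in> events"
      by measurable
    then have meas: "{p. g p < 1} \<in> events" by simp
    have "1 - e \<le> prob {p. g p < 1}" if "0 < e" "e < 1" for e
      using lower[OF that] finite_measure_mono[OF _ meas, of "{p. g p \<le> 1 - e}"] that by force
    then have "1 \<le> prob {p. g p < 1} + e" if "0 < e" for e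
      using that measure_nonneg[of M "{p. g p < 1}"] by (cases "e < 1") (force, linarith)
    then have "1 \<le> prob {p. g p < 1}"
      by (rule field_le_epsilon)
    then have "prob {p. g p < 1} = 1"
      using prob_le_1 antisym by blast
    then show ?thesis
      using meas by (simp add: prob_eq_1)
  qed
  \<comment> \<open>These strips have masses \<open>C 0 1 = 0\<close> and \<open>C 1 0 = 0\<close>,
    and the quadrant below has mass \<open>C 1 1 = 1\<close>. Together they place both coordinates
    in the half-open interval from 0 to 1.\<close>
  have "AE p in M. p \<notin> {..0} \<times> {..1}" "AE p in M. p \<notin> {..1} \<times> {..0}"
    using M[of 0 1] M[of 1 0] C
    by (simp_all add: prob_eq_0 copula_0_left copula_0_right sets_M borel_Times)
  moreover have "AE p in M. p \<in> {..1} \<times> {..1}"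
    using M[of 1 1] C by (simp add: prob_eq_1 copula_1_left sets_M borel_Times)
  moreover have "AE p in M. fst p < 1"
  proof (rule lt1)
    fix e :: real assume "0 < e" "e < 1"
    then have "1 - e = prob ({..1 - e} \<times> {..1})"
      using M[of "1 - e" 1] C by (simp add: copula_1_right)
    also have "\<dots> \<le> prob (fst -` {..1 - e} \<inter> space M)"
      by (intro finite_measure_mono measurable_sets[where A=borel]) auto
    finally show "1 - e \<le> prob {p. fst p \<le> 1 - e}"
      by (simp add: vimage_def)
  qed simp
  moreover have "AE p in M. snd p < 1"
  proof (rule lt1)
    fix e :: real assume "0 < e" "e < 1"
    then have "1 - e = prob ({..1} \<times> {..1 - e})"
      using M[of 1 "1 - e"] C by (simp add: copula_1_left)
    also have "\<dots> \<le> prob (snd -` {..1 - e} \<inter> space M)"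
      by (intro finite_measure_mono measurable_sets[where A=borel]) auto
    finally show "1 - e \<le> prob {p. snd p \<le> 1 - e}"
      by (simp add: vimage_def)
  qed simp
  ultimately have open_unit: "AE p in M. 0 < fst p \<and> fst p < 1 \<and> 0 < snd p \<and> snd p < 1"
    by eventually_elim auto
  note [measurable] = quantile_measurable[OF F] quantile_measurable[OF G]
  let ?T = "\<lambda>p. (quantile F (fst p), quantile G (snd p))"
  have T [measurable]: "?T \<in> measurable M borel"
    by measurable
  have "has_joint_df (distr M borel ?T) (\<lambda>x y. C (F x) (G y))"
    unfolding has_joint_df_def
  proof (intro conjI allI)
    fix x y
    have "measure (distr M borel ?T) ({..x} \<times> {..y}) = prob (?T -` ({..x} \<times> {..y}) \<inter> space M)"
      by (rule measure_distr[OF T]) (simp add: borel_Times)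
    also have "\<dots> = prob ({..F x} \<times> {..G y})"
    proof (rule finite_measure_eq_AE)
      show "AE p in M. p \<in> ?T -` ({..x} \<times> {..y}) \<inter> space M \<longleftrightarrow> p \<in> {..F x} \<times> {..G y}"
        using open_unit by eventually_elim (auto simp: quantile_le_iff F G)
      show "?T -` ({..x} \<times> {..y}) \<inter> space M \<in> events"
        by (rule measurable_sets[OF T]) (simp add: borel_Times)
    qed (rule box)
    also have "\<dots> = C (F x) (G y)"
      using F G by (intro M univariate_df_ge0 univariate_df_le1)
    finally show "measure (distr M borel ?T) ({..x} \<times> {..y}) = C (F x) (G y)" .
  qed (auto intro: prob_space_distr)
  then show ?thesis
    by (subst joint_law_eqI)
qed

lemma copula_swap: "copula C \<Longrightarrow> copula (\<lambda>u v. C v u)"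
  unfolding copula_def by (simp add: algebra_simps)

text \<open>The Lipschitz bound gives \<open>0 \<le> u - C u v \<le> 1 - v\<close>, and
  \<open>v = G (real n)\<close> tends to 1.\<close>

lemma copula_marginal_tendsto:
  assumes C: "copula C" and G: "univariate_df G" and u: "0 \<le> u" "u \<le> 1"
  shows "(\<lambda>n. C u (G (real n))) \<longlonglongrightarrow> u"
proof (rule tendsto_sandwich)
  have lim: "(\<lambda>n. G (real n)) \<longlonglongrightarrow> 1"
    using filterlim_compose[OF univariate_df_at_top[OF G] filterlim_real_sequentially] .
  show "(\<lambda>n. u - (1 - G (real n))) \<longlonglongrightarrow> u"
    using tendsto_diff[OF tendsto_const tendsto_diff[OF tendsto_const lim], of u 1] by simp
  have "0 \<le> u - C u (G (real n)) \<and> u - C u (G (real n)) \<le> 1 - G (real n)" for n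
    using subuniform_copula_right[OF C u] univariate_df_ge0[OF G] univariate_df_le1[OF G]
      copula_1_right[OF C u] unfolding subuniform_def by (metis order_refl)
  then show "\<forall>\<^sub>F n in sequentially. u - (1 - G (real n)) \<le> C u (G (real n))"
    and "\<forall>\<^sub>F n in sequentially. C u (G (real n)) \<le> u"
    by (auto simp: algebra_simps)
qed simp

text \<open>Quadrants with one bound sent to infinity increase to a half-plane, and continuity from
  below gives its mass. The second coordinate uses the swapped copula.\<close>

lemma
  assumes C: "copula C" and F: "univariate_df F" and G: "univariate_df G"
    and M: "has_joint_df M (\<lambda>x y. C (F x) (G y))"
  shows distr_fst_joint_law: "distr M borel fst = interval_measure F"
    and distr_snd_joint_law: "distr M borel snd = interval_measure G"
proof -
  interpret prob_space M using M by (simp add: has_joint_df_def)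
  have sets_M: "sets M = sets borel"
    and df: "measure M ({..x} \<times> {..y}) = C (F x) (G y)" for x y
    using M by (auto simp: has_joint_df_def)
  have sets_M_prod [measurable_cong]: "sets M = sets (borel \<Otimes>\<^sub>M borel)"
    by (simp only: sets_M borel_prod)
  have sp [simp]: "space M = UNIV"
    using sets_eq_imp_space_eq[OF sets_M] by simp
  show "distr M borel fst = interval_measure F"
  proof (rule cdf_unique)
    have "cdf (distr M borel fst) x = F x" for x
    proof (rule LIMSEQ_unique)
      have "(\<lambda>n. prob ({..x} \<times> {..real n})) \<longlonglongrightarrow> prob (\<Union>n. {..x} \<times> {..real n})"
        by (intro finite_Lim_measure_incseq) (auto simp: sets_M borel_Times incseq_def)
      moreover have "(\<Union>n. {..x} \<times> {..real n}) = fst -` {..x} \<inter> space M"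
        by (auto intro: real_arch_simple)
      ultimately show "(\<lambda>n. C (F x) (G (real n))) \<longlonglongrightarrow> cdf (distr M borel fst) x"
        by (simp add: df cdf_def measure_distr)
    qed (rule copula_marginal_tendsto[OF C G univariate_df_ge0[OF F] univariate_df_le1[OF F]])
    then show "cdf (distr M borel fst) = cdf (interval_measure F)"
      by (simp add: cdf_univariate_df[OF F] fun_eq_iff)
  qed (simp_all add: real_distribution_univariate_df[OF F] real_distribution_distr)
  show "distr M borel snd = interval_measure G"
  proof (rule cdf_unique)
    have "cdf (distr M borel snd) y = G y" for y
    proof (rule LIMSEQ_unique)
      have "(\<lambda>n. prob ({..real n} \<times> {..y})) \<longlonglongrightarrow> prob (\<Union>n. {..real n} \<times> {..y})"
        by (intro finite_Lim_measure_incseq) (auto simp: sets_M borel_Times incseq_def)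
      moreover have "(\<Union>n. {..real n} \<times> {..y}) = snd -` {..y} \<inter> space M"
        by (auto intro: real_arch_simple)
      ultimately show "(\<lambda>n. C (F (real n)) (G y)) \<longlonglongrightarrow> cdf (distr M borel snd) y"
        by (simp add: df cdf_def measure_distr)
    qed (rule copula_marginal_tendsto[OF copula_swap[OF C] F univariate_df_ge0[OF G] univariate_df_le1[OF G]])
    then show "cdf (distr M borel snd) = cdf (interval_measure G)"
      by (simp add: cdf_univariate_df[OF G] fun_eq_iff)
  qed (simp_all add: real_distribution_univariate_df[OF G] real_distribution_distr)
qed

section \<open>Copulas from order statistics\<close>

text \<open>The polynomials \<open>B\<^sub>k\<close> of the overview: for \<open>u\<close> in the
  unit interval, the probability of at least \<open>k\<close> successes in \<open>n\<close>
  independent trials with success probability \<open>u\<close>.\<close>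

definition order_stat_poly :: "nat \<Rightarrow> nat \<Rightarrow> real \<Rightarrow> real" where
  "order_stat_poly n k = order_stat_df (\<lambda>u. u) k n"

lemma order_stat_df_eq: "order_stat_df F k n x = order_stat_poly n k (F x)"
  by (simp add: order_stat_poly_def order_stat_df_def)

text \<open>The binomial theorem for \<open>u + (1 - u) = 1\<close>. The index 0 belongs to no order
  statistic but starts the recurrences below.\<close>

lemma order_stat_poly_0: "order_stat_poly n 0 u = 1"
  using binomial_ring[of u "1 - u" n]
  by (simp add: order_stat_poly_def order_stat_df_def atMost_atLeast0)

lemma order_stat_poly_beyond: "n < k \<Longrightarrow> order_stat_poly n k u = 0"
  by (simp add: order_stat_poly_def order_stat_df_def)

lemma order_stat_poly_step:
  "order_stat_poly n k u - order_stat_poly n (Suc k) u = real (n choose k) * u ^ k * (1 - u) ^ (n - k)"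
  by (cases "k \<le> n")
    (simp_all add: order_stat_poly_def order_stat_df_def sum.atLeast_Suc_atMost binomial_eq_0)

text \<open>The recurrence obtained by conditioning on the last of the \<open>n + 1\<close> samples.\<close>

lemma order_stat_poly_Suc:
  "order_stat_poly (Suc n) (Suc k) u = u * order_stat_poly n k u + (1 - u) * order_stat_poly n (Suc k) u"
proof (cases "k \<le> n")
  case False
  then show ?thesis by (simp add: order_stat_poly_beyond)
next
  case True
  then show ?thesis
  proof (induction k rule: inc_induct)
    case base
    show ?case
      using order_stat_poly_step[of n n u] order_stat_poly_step[of "Suc n" "Suc n" u]
      by (simp add: order_stat_poly_beyond)
  next
    case (step k)
    define w where "w = (1 - u) ^ (n - k)"
    have w: "w = (1 - u) * (1 - u) ^ (n - Suc k)"
      unfolding w_def using step.hyps by (metis Suc_diff_Suc power_Suc)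
    \<comment> \<open>The induction descends from \<open>k = n\<close>. Passing from
      \<open>Suc k\<close> to \<open>k\<close> adds one binomial term to each of the three
      polynomials, and Pascal's rule balances these terms.\<close>
    have "order_stat_poly (Suc n) (Suc k) u = order_stat_poly (Suc n) (Suc (Suc k)) u
        + (real (n choose k) + real (n choose Suc k)) * u ^ Suc k * w"
      using order_stat_poly_step[of "Suc n" "Suc k" u] by (simp add: w_def)
    moreover have "u * order_stat_poly n k u = u * order_stat_poly n (Suc k) u + real (n choose k) * u ^ Suc k * w"
      using arg_cong[OF order_stat_poly_step[of n k u], of "(*) u"] by (simp add: w_def algebra_simps)
    moreover have "(1 - u) * order_stat_poly n (Suc k) u
        = (1 - u) * order_stat_poly n (Suc (Suc k)) u + real (n choose Suc k) * u ^ Suc k * w"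
      using arg_cong[OF order_stat_poly_step[of n "Suc k" u], of "(*) (1 - u)"] unfolding w
      by (simp only: right_diff_distrib) (simp add: ac_simps)
    ultimately show ?case
      using step.IH by (simp only: distrib_right)
  qed
qed

text \<open>By the recurrence the polynomial is a convex combination of two earlier ones. Raising
  \<open>u\<close> to \<open>v\<close> shifts weight to the larger of them, and then increases both
  by induction.\<close>

lemma order_stat_poly_mono:
  assumes "0 \<le> u" "u \<le> v" "v \<le> 1"
  shows "order_stat_poly n k u \<le> order_stat_poly n k v"
proof (induction n arbitrary: k)
  case 0
  show ?case by (cases k) (simp_all add: order_stat_poly_0 order_stat_poly_beyond)
next
  case (Suc n)
  show ?case
  proof (cases k)
    case (Suc j)
    have dec: "order_stat_poly n (Suc j) u \<le> order_stat_poly n j u"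
      using order_stat_poly_step[of n j u] assms
      by (smt (verit) mult_nonneg_nonneg of_nat_0_le_iff zero_le_power)
    have "order_stat_poly (Suc n) k u = order_stat_poly n (Suc j) u + u * (order_stat_poly n j u - order_stat_poly n (Suc j) u)"
      by (simp add: Suc order_stat_poly_Suc algebra_simps)
    also have "\<dots> \<le> order_stat_poly n (Suc j) u + v * (order_stat_poly n j u - order_stat_poly n (Suc j) u)"
      using dec assms by (intro add_left_mono mult_right_mono) auto
    also have "\<dots> = v * order_stat_poly n j u + (1 - v) * order_stat_poly n (Suc j) u"
      by (simp add: algebra_simps)
    also have "\<dots> \<le> v * order_stat_poly n j v + (1 - v) * order_stat_poly n (Suc j) v"
      using assms Suc.IH by (intro add_mono mult_left_mono) auto
    finally show ?thesis
      by (simp add: Suc order_stat_poly_Suc)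
  qed (simp add: order_stat_poly_0)
qed

lemma order_stat_poly_at_0: "0 < k \<Longrightarrow> order_stat_poly n k 0 = 0"
  by (auto simp: order_stat_poly_def order_stat_df_def power_0_left)

lemma order_stat_poly_at_1:
  assumes "k \<le> n"
  shows "order_stat_poly n k 1 = 1"
proof -
  have "order_stat_poly n k 1 = (\<Sum>i=k..n. if i = n then 1 else 0)"
    unfolding order_stat_poly_def order_stat_df_def by (rule sum.cong) (auto simp: power_0_left)
  then show ?thesis using assms by simp
qed

lemma order_stat_poly_mem_unit:
  assumes "0 < k" "k \<le> n" "0 \<le> u" "u \<le> 1"
  shows "0 \<le> order_stat_poly n k u" "order_stat_poly n k u \<le> 1"
  using order_stat_poly_mono[of 0 u n k] order_stat_poly_mono[of u 1 n k] assms
  by (simp_all add: order_stat_poly_at_0 order_stat_poly_at_1)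

text \<open>The tail-sum formula for the mean \<open>n * u\<close> of a binomial variable, proved by
  induction through the recurrence. It is the reason why averaging over \<open>k\<close> restores
  uniform marginals.\<close>

lemma sum_order_stat_poly: "(\<Sum>k=1..n. order_stat_poly n k u) = real n * u"
proof (induction n)
  case (Suc n)
  have "(\<Sum>k=1..Suc n. order_stat_poly (Suc n) k u) = (\<Sum>k=0..n. order_stat_poly (Suc n) (Suc k) u)"
    by (simp only: sum.shift_bounds_cl_Suc_ivl One_nat_def)
  also have "\<dots> = u * (\<Sum>k=0..n. order_stat_poly n k u) + (1 - u) * (\<Sum>k=0..n. order_stat_poly n (Suc k) u)"
    by (simp add: order_stat_poly_Suc sum.distrib sum_distrib_left)
  also have "(\<Sum>k=0..n. order_stat_poly n k u) = 1 + real n * u"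
    using Suc by (simp add: sum.atLeast_Suc_atMost[of 0] order_stat_poly_0)
  also have "(\<Sum>k=0..n. order_stat_poly n (Suc k) u) = (\<Sum>k=1..Suc n. order_stat_poly n k u)"
    by (simp only: sum.shift_bounds_cl_Suc_ivl One_nat_def)
  also have "\<dots> = real n * u"
    using Suc by (simp add: order_stat_poly_beyond)
  finally show ?case by (simp add: algebra_simps)
qed simp

section \<open>Averages of a copula over the order statistics\<close>

definition copula_mixture ::
  "nat \<Rightarrow> (nat \<Rightarrow> nat) \<Rightarrow> (real \<Rightarrow> real \<Rightarrow> real) \<Rightarrow> real \<Rightarrow> real \<Rightarrow> real" where
  "copula_mixture n \<pi> C u v =
     1 / real n * (\<Sum>k=1..n. C (order_stat_poly n k u) (order_stat_poly n (\<pi> k) v))"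

text \<open>Each summand inherits the rectangle inequality because the polynomials are increasing,
  but its marginals are polynomials \<open>B\<^sub>k\<close>; only the average over all
  \<open>k\<close> makes them uniform. Bijectivity of \<open>\<pi>\<close> lets the second marginal
  be reindexed.\<close>

lemma copula_mixture_copula:
  assumes C: "copula C" and n: "1 \<le> n" and \<pi>: "bij_betw \<pi> {1..n} {1..n}"
  shows "copula (copula_mixture n \<pi> C)"
proof -
  let ?B = "order_stat_poly n"
  have pi_range: "0 < \<pi> k" "\<pi> k \<le> n" if "k \<in> {1..n}" for k
    using bij_betwE[OF \<pi>] that by fastforce+
  have mem: "0 \<le> ?B k u" "?B k u \<le> 1" "0 \<le> ?B (\<pi> k) u" "?B (\<pi> k) u \<le> 1"
    if "0 \<le> u" "u \<le> 1" "k \<in> {1..n}" for k u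
    using that pi_range[of k] by (auto intro!: order_stat_poly_mem_unit)
  have ge0: "0 \<le> copula_mixture n \<pi> C u v" if "0 \<le> u" "u \<le> 1" "0 \<le> v" "v \<le> 1" for u v
    unfolding copula_mixture_def
    using that by (intro mult_nonneg_nonneg sum_nonneg copula_mem_unit[OF C] mem) auto
  have le1: "copula_mixture n \<pi> C u v \<le> 1" if "0 \<le> u" "u \<le> 1" "0 \<le> v" "v \<le> 1" for u v
  proof -
    have "(\<Sum>k=1..n. C (?B k u) (?B (\<pi> k) v)) \<le> (\<Sum>k=1..n. 1)"
      using that by (intro sum_mono copula_mem_unit[OF C] mem) auto
    then show ?thesis
      using n by (simp add: copula_mixture_def field_simps)
  qed
  have marginal_left: "copula_mixture n \<pi> C u 1 = u" if "0 \<le> u" "u \<le> 1" for u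
  proof -
    have "(\<Sum>k=1..n. C (?B k u) (?B (\<pi> k) 1)) = (\<Sum>k=1..n. ?B k u)"
      using that pi_range by (intro sum.cong) (simp_all add: order_stat_poly_at_1 copula_1_right[OF C] mem)
    then show ?thesis
      using n sum_order_stat_poly[of n u] by (simp add: copula_mixture_def)
  qed
  have marginal_right: "copula_mixture n \<pi> C 1 v = v" if "0 \<le> v" "v \<le> 1" for v
  proof -
    have "(\<Sum>k=1..n. C (?B k 1) (?B (\<pi> k) v)) = (\<Sum>k=1..n. ?B (\<pi> k) v)"
      using that by (intro sum.cong) (simp_all add: order_stat_poly_at_1 copula_1_left[OF C] mem)
    also have "\<dots> = (\<Sum>k=1..n. ?B k v)"
      by (rule sum.reindex_bij_betw[OF \<pi>])
    finally show ?thesis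
      using n sum_order_stat_poly[of n v] by (simp add: copula_mixture_def)
  qed
  have zero: "copula_mixture n \<pi> C u 0 = 0" "copula_mixture n \<pi> C 0 u = 0" if "0 \<le> u" "u \<le> 1" for u
    using that pi_range
    by (simp_all add: copula_mixture_def order_stat_poly_at_0 copula_0_left[OF C] copula_0_right[OF C] mem)
  have rect: "copula_mixture n \<pi> C x2 y2 - copula_mixture n \<pi> C x2 y1
      - copula_mixture n \<pi> C x1 y2 + copula_mixture n \<pi> C x1 y1 \<ge> 0"
    if x: "0 \<le> x1" "x1 < x2" "x2 \<le> 1" and y: "0 \<le> y1" "y1 < y2" "y2 \<le> 1" for x1 x2 y1 y2
  proof -
    have "0 \<le> C (?B k x2) (?B (\<pi> k) y2) - C (?B k x2) (?B (\<pi> k) y1)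
        - C (?B k x1) (?B (\<pi> k) y2) + C (?B k x1) (?B (\<pi> k) y1)" if k: "k \<in> {1..n}" for k
      using copula_2_increasing[OF C, of "?B k x1" "?B k x2" "?B (\<pi> k) y1" "?B (\<pi> k) y2"]
        x y k mem order_stat_poly_mono[of x1 x2 n k] order_stat_poly_mono[of y1 y2 n "\<pi> k"] by simp
    then have "0 \<le> 1 / real n * (\<Sum>k=1..n. C (?B k x2) (?B (\<pi> k) y2) - C (?B k x2) (?B (\<pi> k) y1)
        - C (?B k x1) (?B (\<pi> k) y2) + C (?B k x1) (?B (\<pi> k) y1))"
      by (intro mult_nonneg_nonneg sum_nonneg) auto
    then show ?thesis
      by (simp add: copula_mixture_def sum.distrib sum_subtractf diff_divide_distrib add_divide_distrib)
  qed
  show ?thesis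
    unfolding copula_def using ge0 le1 marginal_left marginal_right zero rect by auto
qed

lemma copula_mixture_mono:
  assumes "\<pi> ` {1..n} \<subseteq> {1..n}"
    and "\<And>u v. 0 \<le> u \<Longrightarrow> u \<le> 1 \<Longrightarrow> 0 \<le> v \<Longrightarrow> v \<le> 1 \<Longrightarrow> C u v \<le> D u v"
    and "0 \<le> u" "u \<le> 1" "0 \<le> v" "v \<le> 1"
  shows "copula_mixture n \<pi> C u v \<le> copula_mixture n \<pi> D u v"
  unfolding copula_mixture_def
  using assms by (intro mult_left_mono sum_mono assms(2) order_stat_poly_mem_unit) fastforce+

lemma copula_product: "copula (\<lambda>u v. u * v)"
proof -
  have "0 \<le> (x2 - x1) * (y2 - y1)" if "x1 < x2" "y1 < y2" for x1 x2 y1 y2 :: real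
    using that by simp
  then show ?thesis
    by (auto simp: copula_def mult_le_one algebra_simps)
qed

lemma G_plus_eq: "G_plus n C FX FY = (\<lambda>x y. copula_mixture n (\<lambda>k. k) C (FX x) (FY y))"
  and G_minus_eq: "G_minus n C FX FY = (\<lambda>x y. copula_mixture n (\<lambda>k. n - k + 1) C (FX x) (FY y))"
  and H_plus_eq: "H_plus n FX FY = (\<lambda>x y. copula_mixture n (\<lambda>k. k) (\<lambda>u v. u * v) (FX x) (FY y))"
  and H_minus_eq: "H_minus n FX FY = (\<lambda>x y. copula_mixture n (\<lambda>k. n - k + 1) (\<lambda>u v. u * v) (FX x) (FY y))"
  by (simp_all add: G_plus_def G_minus_def H_plus_def H_minus_def copula_mixture_def order_stat_df_eq fun_eq_iff)

lemma bij_betw_reverse: "bij_betw (\<lambda>k. n - k + 1) {1..n} {1..n::nat}"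
  by (rule bij_betw_byWitness[where f'="\<lambda>k. n - k + 1"]) auto

section \<open>Monotonicity of mixed moments\<close>

text \<open>The indices that fail the test are those below \<open>nat \<lceil>z\<rceil>\<close>;
  \<open>nat\<close> covers negative \<open>z\<close>, and \<open>min\<close> covers thresholds
  beyond \<open>N\<close>.\<close>

lemma sum_threshold: "(\<Sum>i<N. of_bool (z \<le> real i)) = real N - real (min N (nat \<lceil>z\<rceil>))"
proof (induction N)
  case (Suc N)
  have "z \<le> real N \<longleftrightarrow> nat \<lceil>z\<rceil> \<le> N"
    by (simp add: nat_le_iff ceiling_le_iff)
  then have "(\<Sum>i<Suc N. of_bool (z \<le> real i)) = real N - real (min N (nat \<lceil>z\<rceil>)) + of_bool (nat \<lceil>z\<rceil> \<le> N)"
    by (simp only: sum.lessThan_Suc Suc)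
  also have "real N - real (min N k) + of_bool (k \<le> N) = real (Suc N) - real (min (Suc N) k)" for k
    by (auto simp: min_def)
  finally show ?case .
qed simp

text \<open>A step function with values in \<open>[-m, m]\<close> and steps of size \<open>1 / m\<close>, written as a combination
  of indicators of half-lines so that mixed moments are read off the joint distribution function.\<close>

definition stair :: "nat \<Rightarrow> real \<Rightarrow> real" where
  "stair m x = real m - 1 / real m * (\<Sum>i<2 * m\<^sup>2. of_bool (x \<le> real i / real m - real m))"

text \<open>Shows that \<open>stair m\<close> rounds \<open>x\<close> up to the grid of mesh
  \<open>1 / m\<close> and clips the result to the range from \<open>-m\<close> to
  \<open>m\<close>.\<close>

lemma stair_eq:
  assumes "0 < m"
  shows "stair m x = real (min (2 * m\<^sup>2) (nat \<lceil>real m * (x + real m)\<rceil>)) / real m - real m"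
proof -
  have "x \<le> real i / real m - real m \<longleftrightarrow> real m * (x + real m) \<le> real i" for i
    using assms by (simp add: field_simps)
  then have "(\<Sum>i<2 * m\<^sup>2. of_bool (x \<le> real i / real m - real m))
      = real (2 * m\<^sup>2) - real (min (2 * m\<^sup>2) (nat \<lceil>real m * (x + real m)\<rceil>))"
    using sum_threshold[where N="2 * m\<^sup>2" and z="real m * (x + real m)"] by simp
  then show ?thesis
    using assms unfolding stair_def
    by (simp add: diff_divide_distrib power2_eq_square)
qed

lemma stair_close:
  assumes "0 < m" "\<bar>x\<bar> \<le> real m"
  shows "\<bar>stair m x - x\<bar> \<le> 1 / real m"
proof -
  let ?z = "real m * (x + real m)"
  have z: "0 \<le> ?z" "?z \<le> real (2 * m\<^sup>2)"
    using assms mult_left_mono[of "x + real m" "2 * real m" "real m"] by (auto simp: power2_eq_square)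
  have "nat \<lceil>?z\<rceil> \<le> 2 * m\<^sup>2"
    using z(2) by (simp only: nat_le_iff ceiling_le_iff of_int_of_nat_eq)
  then have "stair m x - x = (real_of_int \<lceil>?z\<rceil> - ?z) / real m"
    using assms z(1) by (simp add: stair_eq min_absorb2 field_simps)
  moreover have "0 \<le> real_of_int \<lceil>?z\<rceil> - ?z" "real_of_int \<lceil>?z\<rceil> - ?z \<le> 1"
    by linarith+
  ultimately show ?thesis
    using assms by (simp add: divide_right_mono)
qed

text \<open>Uniform in \<open>m\<close>, as dominated convergence requires. Beyond \<open>m\<close>
  clipping keeps the value within \<open>m\<close>, hence below
  \<open>\<bar>x\<bar>\<close>.\<close>

lemma stair_abs_le:
  assumes "0 < m"
  shows "\<bar>stair m x\<bar> \<le> \<bar>x\<bar> + 1"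
proof (cases "\<bar>x\<bar> \<le> real m")
  case True
  moreover have "1 / real m \<le> 1" using assms by simp
  ultimately show ?thesis
    using stair_close[OF assms True] by linarith
next
  case False
  let ?k = "real (min (2 * m\<^sup>2) (nat \<lceil>real m * (x + real m)\<rceil>))"
  have "0 \<le> ?k / real m" "?k / real m \<le> real (2 * m\<^sup>2) / real m"
    by (simp, intro divide_right_mono of_nat_mono) auto
  moreover have "real (2 * m\<^sup>2) / real m = 2 * real m"
    using assms by (simp add: power2_eq_square)
  ultimately show ?thesis
    using False stair_eq[OF assms, of x] by linarith
qed

lemma stair_tendsto: "(\<lambda>m. stair (Suc m) x) \<longlonglongrightarrow> x"
proof (rule Lim_transform[of "\<lambda>_. x"])
  show "(\<lambda>m. stair (Suc m) x - x) \<longlonglongrightarrow> 0"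
  proof (rule Lim_null_comparison)
    obtain N where "\<bar>x\<bar> \<le> real N" using real_arch_simple by blast
    then have "norm (stair (Suc m) x - x) \<le> 1 / real (Suc m)" if "N \<le> m" for m
      using that stair_close[of "Suc m" x] by simp
    then show "\<forall>\<^sub>F m in sequentially. norm (stair (Suc m) x - x) \<le> 1 / real (Suc m)"
      by (auto simp: eventually_sequentially)
    show "(\<lambda>m. 1 / real (Suc m)) \<longlonglongrightarrow> 0"
      using LIMSEQ_Suc[OF lim_1_over_n] by simp
  qed
qed simp

lemma stair_measurable [measurable]: "stair m \<in> borel_measurable borel"
  unfolding stair_def by measurable

lemma
  assumes "has_joint_df M H"
  shows has_joint_df_sets: "sets M = sets (borel \<Otimes>\<^sub>M borel)"
    and has_joint_df_space: "space M = UNIV"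
    and has_joint_df_prob: "prob_space M"
    and has_joint_df_measure: "measure M ({..x} \<times> {..y}) = H x y"
proof -
  show "sets M = sets (borel \<Otimes>\<^sub>M borel)"
    using assms by (simp only: has_joint_df_def borel_prod)
  then show "space M = UNIV"
    using sets_eq_imp_space_eq[of M borel] by (simp only: borel_prod) simp
qed (use assms in \<open>auto simp: has_joint_df_def\<close>)

lemma (in prob_space)
  assumes [measurable]: "Measurable.pred M P"
  shows expectation_of_bool: "expectation (\<lambda>p. of_bool (P p)) = prob {p \<in> space M. P p}"
    and integrable_of_bool: "integrable M (\<lambda>p. of_bool (P p) :: real)"
proof -
  have eq: "of_bool (P p) = (indicator {p \<in> space M. P p} p :: real)" if "p \<in> space M" for p
    using that by (simp add: indicator_def)
  have sets: "{p \<in> space M. P p} \<in> events"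
    by measurable
  show "expectation (\<lambda>p. of_bool (P p)) = prob {p \<in> space M. P p}"
    using sets by (simp add: eq cong: Bochner_Integration.integral_cong)
  show "integrable M (\<lambda>p. of_bool (P p) :: real)"
    using sets by (simp add: eq less_top[symmetric] cong: Bochner_Integration.integrable_cong)
qed

text \<open>Multiplying out the two sums of indicators leaves single sums that depend on the
  marginals only, and a double sum of values of \<open>H\<close> with a nonnegative coefficient.
  This makes the moment monotone in \<open>H\<close> for fixed marginals.\<close>

lemma stair_moment:
  assumes H: "has_joint_df M H"
  shows "(\<integral>p. stair m (fst p) * stair m (snd p) \<partial>M) =
    (real m)\<^sup>2 - (\<Sum>i<2 * m\<^sup>2. measure (distr M borel fst) {..real i / real m - real m})
      - (\<Sum>j<2 * m\<^sup>2. measure (distr M borel snd) {..real j / real m - real m})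
      + (1 / real m)\<^sup>2 * (\<Sum>i<2 * m\<^sup>2. \<Sum>j<2 * m\<^sup>2. H (real i / real m - real m) (real j / real m - real m))"
proof (cases "m = 0")
  case True
  then show ?thesis by (simp add: stair_def)
next
  case False
  interpret prob_space M by (rule has_joint_df_prob[OF H])
  note [measurable_cong] = has_joint_df_sets[OF H]
  note [simp] = has_joint_df_space[OF H]
  let ?a = "\<lambda>i. real i / real m - real m"
  let ?S = "\<lambda>x. \<Sum>i<2 * m\<^sup>2. of_bool (x \<le> ?a i) :: real"
  note int = integrable_of_bool
  have half_fst: "expectation (\<lambda>p. of_bool (fst p \<le> c)) = measure (distr M borel fst) {..c}"
    and half_snd: "expectation (\<lambda>p. of_bool (snd p \<le> c)) = measure (distr M borel snd) {..c}" for c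
    by (simp_all add: expectation_of_bool measure_distr vimage_def)
  have fst1: "expectation (\<lambda>p. ?S (fst p)) = (\<Sum>i<2 * m\<^sup>2. measure (distr M borel fst) {..?a i})"
    unfolding half_fst[symmetric] by (rule Bochner_Integration.integral_sum) (rule int, measurable)
  have snd1: "expectation (\<lambda>p. ?S (snd p)) = (\<Sum>i<2 * m\<^sup>2. measure (distr M borel snd) {..?a i})"
    unfolding half_snd[symmetric] by (rule Bochner_Integration.integral_sum) (rule int, measurable)
  have prod_eq: "?S x * ?S y = (\<Sum>i<2 * m\<^sup>2. \<Sum>j<2 * m\<^sup>2. of_bool (x \<le> ?a i \<and> y \<le> ?a j))" for x y
    by (simp only: sum_product of_bool_conj)
  have joint: "(\<integral>p. ?S (fst p) * ?S (snd p) \<partial>M) = (\<Sum>i<2 * m\<^sup>2. \<Sum>j<2 * m\<^sup>2. H (?a i) (?a j))"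
  proof -
    have "(\<integral>p. ?S (fst p) * ?S (snd p) \<partial>M)
        = (\<Sum>i<2 * m\<^sup>2. \<Sum>j<2 * m\<^sup>2. \<integral>p. of_bool (fst p \<le> ?a i \<and> snd p \<le> ?a j) \<partial>M)"
      unfolding prod_eq
      by (subst Bochner_Integration.integral_sum, (intro Bochner_Integration.integrable_sum int; measurable),
          intro sum.cong refl, subst Bochner_Integration.integral_sum, (intro int; measurable), rule refl)
    also have "\<dots> = (\<Sum>i<2 * m\<^sup>2. \<Sum>j<2 * m\<^sup>2. H (?a i) (?a j))"
    proof (intro sum.cong refl)
      fix i j
      have "{p. fst p \<le> ?a i \<and> snd p \<le> ?a j} = {..?a i} \<times> {..?a j}"
        by auto
      then show "(\<integral>p. of_bool (fst p \<le> ?a i \<and> snd p \<le> ?a j) \<partial>M) = H (?a i) (?a j)"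
        by (subst expectation_of_bool) (auto simp: has_joint_df_measure[OF H])
    qed
    finally show ?thesis .
  qed
  have int_fst: "integrable M (\<lambda>p. ?S (fst p))" and int_snd: "integrable M (\<lambda>p. ?S (snd p))"
    by (intro Bochner_Integration.integrable_sum int; measurable)+
  have int_joint: "integrable M (\<lambda>p. ?S (fst p) * ?S (snd p))"
    unfolding prod_eq by (intro Bochner_Integration.integrable_sum int; measurable)
  have "stair m x * stair m y = (real m)\<^sup>2 - ?S x - ?S y + (1 / real m)\<^sup>2 * (?S x * ?S y)" for x y
    unfolding stair_def using False by (simp add: field_simps power2_eq_square)
  then have "(\<integral>p. stair m (fst p) * stair m (snd p) \<partial>M)
      = (\<integral>p. (real m)\<^sup>2 - ?S (fst p) - ?S (snd p) + (1 / real m)\<^sup>2 * (?S (fst p) * ?S (snd p)) \<partial>M)"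
    by (simp only:)
  also have "\<dots> = (real m)\<^sup>2 - (\<integral>p. ?S (fst p) \<partial>M) - (\<integral>p. ?S (snd p) \<partial>M)
      + (1 / real m)\<^sup>2 * (\<integral>p. ?S (fst p) * ?S (snd p) \<partial>M)"
    using int_fst int_snd int_joint by (simp add: prob_space[simplified] del: sum_of_bool_eq)
  finally show ?thesis
    by (simp only: fst1 snd1 joint)
qed

lemma stair_moment_tendsto:
  assumes H: "has_joint_df M H"
    and fst2: "integrable M (\<lambda>p. (fst p)\<^sup>2)" and snd2: "integrable M (\<lambda>p. (snd p)\<^sup>2)"
  shows "(\<lambda>m. \<integral>p. stair (Suc m) (fst p) * stair (Suc m) (snd p) \<partial>M) \<longlonglongrightarrow> (\<integral>p. fst p * snd p \<partial>M)"
proof (rule integral_dominated_convergence)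
  interpret prob_space M by (rule has_joint_df_prob[OF H])
  note [measurable_cong] = has_joint_df_sets[OF H]
  show "integrable M (\<lambda>p. (fst p)\<^sup>2 + (snd p)\<^sup>2 + 2)"
    using fst2 snd2 by auto
  show "AE p in M. norm (stair (Suc m) (fst p) * stair (Suc m) (snd p)) \<le> (fst p)\<^sup>2 + (snd p)\<^sup>2 + 2" for m
  proof (rule AE_I2)
    fix p :: "real \<times> real"
    let ?a = "\<bar>fst p\<bar>" and ?b = "\<bar>snd p\<bar>"
    have "norm (stair (Suc m) (fst p) * stair (Suc m) (snd p)) \<le> (?a + 1) * (?b + 1)"
      unfolding real_norm_def abs_mult by (intro mult_mono stair_abs_le) auto
    also have "\<dots> \<le> ?a\<^sup>2 + ?b\<^sup>2 + 2"
    proof -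
      \<comment> \<open>Expanded and halved, this sum of squares is exactly the required
        inequality.\<close>
      have "0 \<le> (?a - ?b)\<^sup>2 + (?a - 1)\<^sup>2 + (?b - 1)\<^sup>2" by simp
      then show ?thesis by (simp add: power2_eq_square algebra_simps)
    qed
    finally show "norm (stair (Suc m) (fst p) * stair (Suc m) (snd p)) \<le> (fst p)\<^sup>2 + (snd p)\<^sup>2 + 2"
      by simp
  qed
  show "AE p in M. (\<lambda>m. stair (Suc m) (fst p) * stair (Suc m) (snd p)) \<longlonglongrightarrow> fst p * snd p"
    by (intro AE_I2 tendsto_mult stair_tendsto)
  show "(\<lambda>p. fst p * snd p) \<in> borel_measurable M"
    "\<And>m. (\<lambda>p. stair (Suc m) (fst p) * stair (Suc m) (snd p)) \<in> borel_measurable M"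
    by measurable
qed

text \<open>A discrete counterpart of Hoeffding's covariance identity: at every \<open>stair\<close>
  level only the double sum over the joint distribution function differs, and the inequality
  survives the limit.\<close>

lemma mixed_moment_mono:
  assumes H: "has_joint_df M H" and K: "has_joint_df N K"
    and fst_eq: "distr M borel fst = distr N borel fst" and snd_eq: "distr M borel snd = distr N borel snd"
    and le: "\<And>x y. H x y \<le> K x y"
    and M2: "integrable M (\<lambda>p. (fst p)\<^sup>2)" "integrable M (\<lambda>p. (snd p)\<^sup>2)"
    and N2: "integrable N (\<lambda>p. (fst p)\<^sup>2)" "integrable N (\<lambda>p. (snd p)\<^sup>2)"
  shows "(\<integral>p. fst p * snd p \<partial>M) \<le> (\<integral>p. fst p * snd p \<partial>N)"
proof (rule LIMSEQ_le[OF stair_moment_tendsto[OF H M2] stair_moment_tendsto[OF K N2]], intro exI allI impI)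
  fix m
  show "(\<integral>p. stair (Suc m) (fst p) * stair (Suc m) (snd p) \<partial>M)
      \<le> (\<integral>p. stair (Suc m) (fst p) * stair (Suc m) (snd p) \<partial>N)"
    unfolding stair_moment[OF H] stair_moment[OF K] fst_eq snd_eq
    by (intro add_left_mono mult_left_mono sum_mono le) simp
qed

section \<open>From mixed moments to correlation coefficients\<close>

lemma integrable_of_square_integrable:
  assumes "univariate_df F" "finite_second_moment F"
  shows "integrable (interval_measure F) (\<lambda>x. x)"
proof -
  interpret real_distribution "interval_measure F"
    by (rule real_distribution_univariate_df[OF assms(1)])
  show ?thesis
    by (rule square_integrable_imp_integrable) (use assms(2) in \<open>simp_all add: finite_second_moment_def\<close>)
qed

text \<open>Means and variances are transferred to the marginal laws, which isolates the mixed
  moment as the only quantity that depends on the copula.\<close>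

lemma joint_law_moments:
  assumes C: "copula C" and F: "univariate_df F" and G: "univariate_df G"
    and F2: "finite_second_moment F" and G2: "finite_second_moment G"
    and M: "has_joint_df M (\<lambda>x y. C (F x) (G y))"
  shows joint_law_square_integrable:
      "integrable M (\<lambda>p. (fst p)\<^sup>2)" "integrable M (\<lambda>p. (snd p)\<^sup>2)"
    and joint_law_correlation: "pearson_correlation M fst snd =
      ((\<integral>p. fst p * snd p \<partial>M) - (\<integral>x. x \<partial>interval_measure F) * (\<integral>x. x \<partial>interval_measure G)) /
      (sqrt (prob_space.variance (interval_measure F) (\<lambda>x. x)) * sqrt (prob_space.variance (interval_measure G) (\<lambda>x. x)))"
proof -
  interpret prob_space M by (rule has_joint_df_prob[OF M])
  interpret F: real_distribution "interval_measure F" by (rule real_distribution_univariate_df[OF F])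
  interpret G: real_distribution "interval_measure G" by (rule real_distribution_univariate_df[OF G])
  note sets_M [measurable_cong] = has_joint_df_sets[OF M]
  note dF = distr_fst_joint_law[OF C F G M] and dG = distr_snd_joint_law[OF C F G M]
  have expF: "(\<integral>p. h (fst p) \<partial>M) = (\<integral>x. h x \<partial>interval_measure F)"
    and intF: "integrable M (\<lambda>p. h (fst p)) \<longleftrightarrow> integrable (interval_measure F) h"
    and expG: "(\<integral>p. h (snd p) \<partial>M) = (\<integral>x. h x \<partial>interval_measure G)"
    and intG: "integrable M (\<lambda>p. h (snd p)) \<longleftrightarrow> integrable (interval_measure G) h"
    if [measurable]: "h \<in> borel_measurable borel" for h :: "real \<Rightarrow> real"
    unfolding dF[symmetric] dG[symmetric] by (simp_all add: integral_distr integrable_distr_eq)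
  show F2': "integrable M (\<lambda>p. (fst p)\<^sup>2)" and G2': "integrable M (\<lambda>p. (snd p)\<^sup>2)"
    using F2 G2 intF[of "\<lambda>x. x\<^sup>2"] intG[of "\<lambda>x. x\<^sup>2"] by (simp_all add: finite_second_moment_def)
  have F1: "integrable M fst" and G1: "integrable M snd"
    using intF[THEN iffD2, OF _ integrable_of_square_integrable[OF F F2]]
      intG[THEN iffD2, OF _ integrable_of_square_integrable[OF G G2]] by simp_all
  let ?\<mu> = "\<integral>x. x \<partial>interval_measure F" and ?\<nu> = "\<integral>x. x \<partial>interval_measure G"
  have E: "expectation fst = ?\<mu>" "expectation snd = ?\<nu>"
    using expF[of "\<lambda>x. x"] expG[of "\<lambda>x. x"] by simp_all
  have V: "variance fst = F.variance (\<lambda>x. x)" "variance snd = G.variance (\<lambda>x. x)"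
    unfolding E using expF[of "\<lambda>x. (x - ?\<mu>)\<^sup>2"] expG[of "\<lambda>x. (x - ?\<nu>)\<^sup>2"] by simp_all
  have int_prod: "integrable M (\<lambda>p. fst p * snd p)"
  proof (rule Bochner_Integration.integrable_bound[of _ "\<lambda>p. (fst p)\<^sup>2 + (snd p)\<^sup>2"])
    have "\<bar>a * b\<bar> \<le> a\<^sup>2 + b\<^sup>2" for a b :: real
      using sum_squares_bound[of "\<bar>a\<bar>" "\<bar>b\<bar>"] mult_nonneg_nonneg[of "\<bar>a\<bar>" "\<bar>b\<bar>"]
      unfolding abs_mult power2_abs by linarith
    then show "AE p in M. norm (fst p * snd p) \<le> norm ((fst p)\<^sup>2 + (snd p)\<^sup>2)"
      by (auto intro!: AE_I2)
  qed (use F2' G2' in auto)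
  have "expectation (\<lambda>p. (fst p - ?\<mu>) * (snd p - ?\<nu>))
      = expectation (\<lambda>p. fst p * snd p - ?\<nu> * fst p - ?\<mu> * snd p + ?\<mu> * ?\<nu>)"
    by (simp add: algebra_simps)
  also have "\<dots> = expectation (\<lambda>p. fst p * snd p) - ?\<mu> * ?\<nu>"
    using F1 G1 int_prod E by (simp add: prob_space)
  finally show "pearson_correlation M fst snd =
      (expectation (\<lambda>p. fst p * snd p) - ?\<mu> * ?\<nu>) / (sqrt (F.variance (\<lambda>x. x)) * sqrt (G.variance (\<lambda>x. x)))"
    unfolding pearson_correlation_def V unfolding E by simp
qed

theorem rho_mono_copula:
  assumes C: "copula C" and D: "copula D"
    and le: "\<And>u v. 0 \<le> u \<Longrightarrow> u \<le> 1 \<Longrightarrow> 0 \<le> v \<Longrightarrow> v \<le> 1 \<Longrightarrow> C u v \<le> D u v"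
    and F: "univariate_df F" and G: "univariate_df G"
    and F2: "finite_second_moment F" and G2: "finite_second_moment G"
  shows "rho (\<lambda>x y. C (F x) (G y)) \<le> rho (\<lambda>x y. D (F x) (G y))"
proof -
  interpret F: real_distribution "interval_measure F" by (rule real_distribution_univariate_df[OF F])
  interpret G: real_distribution "interval_measure G" by (rule real_distribution_univariate_df[OF G])
  note M = joint_law_copula[OF C F G] and N = joint_law_copula[OF D F G]
  have "(\<integral>p. fst p * snd p \<partial>joint_law (\<lambda>x y. C (F x) (G y)))
      \<le> (\<integral>p. fst p * snd p \<partial>joint_law (\<lambda>x y. D (F x) (G y)))"
    by (rule mixed_moment_mono[OF M N])
      (use F G in \<open>simp_all add: distr_fst_joint_law[OF C F G M] distr_fst_joint_law[OF D F G N]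
        distr_snd_joint_law[OF C F G M] distr_snd_joint_law[OF D F G N] le univariate_df_ge0 univariate_df_le1
        joint_law_square_integrable[OF C F G F2 G2 M] joint_law_square_integrable[OF D F G F2 G2 N]\<close>)
  \<comment> \<open>Both coefficients share the subtracted product of means and the nonnegative
    denominator. If a variance vanishes, both quotients are 0 by convention and the inequality still
    holds.\<close>
  then show ?thesis
    unfolding rho_def joint_law_correlation[OF C F G F2 G2 M] joint_law_correlation[OF D F G F2 G2 N]
    by (intro divide_right_mono) (auto intro!: mult_nonneg_nonneg F.variance_positive G.variance_positive)
qed

theorem theorem1:
  fixes n :: nat
    and FX FY :: "real \<Rightarrow> real"
    and C :: "real \<Rightarrow> real \<Rightarrow> real"
  assumes "n \<ge> 1"
    and "univariate_df FX" and "univariate_df FY"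
    and "finite_second_moment FX" and "finite_second_moment FY"
    and "copula C"
  shows "(PQD C \<longrightarrow> rho (G_plus n C FX FY) \<ge> rho (H_plus n FX FY)) \<and>
         (NQD C \<longrightarrow> rho (G_minus n C FX FY) \<le> rho (H_minus n FX FY))"
proof (intro conjI impI)
  have id: "bij_betw (\<lambda>k. k) {1..n} {1..n}" by (simp add: bij_betw_def)
  note mixture = copula_mixture_copula[OF _ \<open>n \<ge> 1\<close>]
  \<comment> \<open>Quadrant dependence compares \<open>C\<close> pointwise with the product copula,
    and averaging preserves the comparison. The plus case pairs equal ranks; the minus case below
    pairs rank \<open>k\<close> with \<open>n - k + 1\<close>.\<close>
  show "rho (H_plus n FX FY) \<le> rho (G_plus n C FX FY)" if "PQD C"
    unfolding H_plus_eq G_plus_eq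
  proof (rule rho_mono_copula[OF mixture[OF copula_product id] mixture[OF \<open>copula C\<close> id] _ assms(2-5)])
    show "copula_mixture n (\<lambda>k. k) (\<lambda>u v. u * v) u v \<le> copula_mixture n (\<lambda>k. k) C u v"
      if "0 \<le> u" "u \<le> 1" "0 \<le> v" "v \<le> 1" for u v
      using that \<open>PQD C\<close> by (intro copula_mixture_mono) (auto simp: PQD_def)
  qed
  show "rho (G_minus n C FX FY) \<le> rho (H_minus n FX FY)" if "NQD C"
    unfolding H_minus_eq G_minus_eq
  proof (rule rho_mono_copula[OF mixture[OF \<open>copula C\<close> bij_betw_reverse] mixture[OF copula_product bij_betw_reverse] _ assms(2-5)])
    show "copula_mixture n (\<lambda>k. n - k + 1) C u v \<le> copula_mixture n (\<lambda>k. n - k + 1) (\<lambda>u v. u * v) u v"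
      if "0 \<le> u" "u \<le> 1" "0 \<le> v" "v \<le> 1" for u v
      using that \<open>NQD C\<close> by (intro copula_mixture_mono) (auto simp: NQD_def)
  qed
qed

end
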